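(* Let $f_1,\dots,f_M\in\mathcal{H}(\mathbb{C})$ be such that $\rho(f_i)\neq\rho(f_j)$ whenever $i\neq j$. Then $$\rho\big(P(f_1,\dots,f_M)\big)=\max_{k\in\mathcal{I}_P}\rho(f_k)$$ for all non-constant polynomials $P\in\mathbb{C}[z_1,\dots,z_M]$. Moreover, $(f_k)_{k=1}^M$ is algebraically independent and generates a free algebra.
   Context: $\mathcal{H}(\mathbb{C})$ denotes the space of all entire functions from $\mathbb{C}$ to $\mathbb{C}$; it is a commutative complex algebra with pointwise operations. $M$ is a positive integer. For $f\in\mathcal{H}(\mathbb{C})$ and $r>0$, put $M(f,r)=\max_{|z|=r}|f(z)|$. The (growth) order $\rho(f)\in[0,+\infty]$ of $f$ is the infimum of all positive real numbers $\alpha$ for which there is $r(\alpha)>0$ such that $M(f,r)<e^{r^\alpha}$ for all $r>r(\alpha)$ (with $\inf\varnothing=+\infty$). The order of a constant map is $0$, and for non-constant $f$ one has $\rho(f)=\limsup_{r\to+\infty}\frac{\log\log M(f,r)}{\log r}$. For a non-constant polynomial $P\in\mathbb{C}[z_1,\dots,z_M]$ in $M$ complex variables, $\mathcal{I}_P\subset\{1,\dots,M\}$ is the set of indices $k$ such that the variable $z_k$ explicitly appears in some monomial of $P$ with non-zero coefficient, i.e. $\mathcal{I}_P=\{k\in\{1,\dots,M\}:\ \partial P/\partial z_k\not\equiv 0\}$. Algebraic independence and generating a free algebra are meant over $\mathbb{C}$: $P(f_1,\dots,f_M)\not\equiv 0$ for every nonzero polynomial $P\in\mathbb{C}[z_1,\dots,z_M]$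 (for the free algebra generated, every nonzero polynomial without constant term).
   Formalization: The functions f_1,…,f_M are additionally assumed non-constant; if some f_k equals a constant c, then z_k − c (or z_k² − c z_k) vanishes at them, so algebraic independence and freeness fail. *)

theory Defs
  imports "HOL-Complex_Analysis.Complex_Analysis" "HOL-Library.Poly_Mapping"
begin

section \<open>Growth order of entire functions\<close>

text \<open>For continuous \<open>f\<close> and \<open>r > 0\<close> the supremum is attained, since the circle is compact and
  non-empty; so this is the maximum.\<close>

definition max_modulus :: "(complex \<Rightarrow> complex) \<Rightarrow> real \<Rightarrow> real" where
  "max_modulus f r = (SUP z\<in>sphere 0 r. norm (f z))"

text \<open>The infimum is taken in the extended reals, so that the infimum of the empty set is \<open>\<infinity>\<close>.\<close>

definition growth_order :: "(complex \<Rightarrow> complex) \<Rightarrow> ereal" where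
  "growth_order f =
     Inf {ereal \<alpha> | \<alpha>. \<alpha> > 0 \<and> (\<exists>r\<^sub>0>0. \<forall>r>r\<^sub>0. max_modulus f r < exp (r powr \<alpha>))}"

section \<open>Complex polynomials in finitely many variables\<close>

text \<open>A monomial is a finitely supported exponent map \<open>m\<close>, standing for the product of the
  \<open>z\<^sub>k ^ lookup m k\<close>; a polynomial is a finitely supported map from monomials to coefficients.
  The ring operations on this type (with convolution as product) come from the library.
  The type has variables \<open>z\<^sub>k\<close> for all natural numbers \<open>k\<close>; \<open>mpolys M\<close> is the ring
  of polynomials in \<open>z\<^sub>1, \<dots>, z\<^sub>M\<close>.\<close>

type_synonym cmpoly = "(nat \<Rightarrow>\<^sub>0 nat) \<Rightarrow>\<^sub>0 complex"

definition occurring_vars :: "cmpoly \<Rightarrow> nat set" where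
  "occurring_vars P = (\<Union>m\<in>Poly_Mapping.keys P. Poly_Mapping.keys m)"

definition mpolys :: "nat \<Rightarrow> cmpoly set" where
  "mpolys M = {P. occurring_vars P \<subseteq> {1..M}}"

definition constant_mpoly :: "cmpoly \<Rightarrow> bool" where
  "constant_mpoly P \<longleftrightarrow> (\<exists>c. P = Poly_Mapping.single 0 c)"

definition mpoly_eval :: "cmpoly \<Rightarrow> (nat \<Rightarrow> complex) \<Rightarrow> complex" where
  "mpoly_eval P a = (\<Sum>m\<in>Poly_Mapping.keys P. Poly_Mapping.lookup P m *
     (\<Prod>k\<in>Poly_Mapping.keys m. a k ^ Poly_Mapping.lookup m k))"

text \<open>\<open>P(f\<^sub>1, \<dots>, f\<^sub>M)\<close> in the algebra of functions with pointwise operations.\<close>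

definition mpoly_comp :: "cmpoly \<Rightarrow> (nat \<Rightarrow> complex \<Rightarrow> complex) \<Rightarrow> complex \<Rightarrow> complex" where
  "mpoly_comp P f = (\<lambda>z. mpoly_eval P (\<lambda>k. f k z))"

definition algebraically_independent :: "nat \<Rightarrow> (nat \<Rightarrow> complex \<Rightarrow> complex) \<Rightarrow> bool" where
  "algebraically_independent M f \<longleftrightarrow>
     (\<forall>P\<in>mpolys M. P \<noteq> 0 \<longrightarrow> mpoly_comp P f \<noteq> (\<lambda>z. 0))"

text \<open>The algebra generated is the not necessarily unital one, consisting of the values
  of the polynomials without constant term.\<close>

definition generates_free_algebra :: "nat \<Rightarrow> (nat \<Rightarrow> complex \<Rightarrow> complex) \<Rightarrow> bool" where
  "generates_free_algebra M f \<longleftrightarrow>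
     (\<forall>P\<in>mpolys M. P \<noteq> 0 \<and> Poly_Mapping.lookup P 0 = 0 \<longrightarrow> mpoly_comp P f \<noteq> (\<lambda>z. 0))"

end

theory Submission
  imports Defs "HOL-Real_Asymp.Real_Asymp"
begin

text \<open>The order of a polynomial in entire functions cannot exceed the largest order of these functions,
  because the entire functions of order below a given bound form an algebra. The point is that no
  cancellation lowers the order. Let \<open>f N\<close> be the function of largest order \<open>\<beta>\<close> among those that occur,
  unique because the orders are distinct, and write
  \<open>P(f) = (\<Sum>j\<le>d. Q j * f N ^ j)\<close> with \<open>d \<ge> 1\<close> and coefficients \<open>Q j\<close> that are polynomials in the
  other functions. The coefficients have order below \<open>\<beta>\<close> or are constant. Suppose that the same holds
  for \<open>P(f)\<close>. The elementary bound \<open>\<bar>Q d * f N\<bar> \<le> \<bar>P(f)\<bar> + (\<Sum>j\<le>d. \<bar>Q j\<bar>)\<close> (\<open>leading_term_bound\<close>) then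
  makes the entire function \<open>Q d * f N\<close> small, and \<open>f N\<close> is its quotient by \<open>Q d\<close>, so that \<open>f N\<close> itself
  has order below \<open>\<beta>\<close> or is constant (\<open>slow_quotient\<close>): a contradiction
  (\<open>slow_var_if_slow_mpoly_comp\<close>).

  Division needs \<open>Q d\<close> not to vanish identically. This is the algebraic independence of the other
  functions; it is proved by induction on the number of variables, by the same contradiction with
  \<open>P(f) = 0\<close> (\<open>mpoly_comp_nonzero\<close>).

  The analytic ingredient is that an entire quotient \<open>h / q\<close> does not have larger order than \<open>h\<close> and \<open>q\<close>.
  The zeros of \<open>q\<close> in a disc are divided out by Blaschke factors, giving a function \<open>u\<close> that has no zeros
  there and the same modulus as \<open>q\<close> on the circle bounding a larger disc.
  The maximum principle bounds \<open>\<bar>(h / q) * u\<bar>\<close> in the larger disc, and Harnack's inequality bounds \<open>\<bar>u\<bar>\<close> from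
  below on a disc smaller than both (\<open>quotient_bound\<close>).\<close>

section \<open>Bounds for quotients of entire functions\<close>

lemma ball_modulus_bound:
  assumes f: "f holomorphic_on UNIV" and B: "\<And>z. z \<in> sphere c r \<Longrightarrow> norm (f z) \<le> B"
    and z: "z \<in> cball c r"
  shows "norm (f z) \<le> B"
proof (cases "r > 0")
  case True
  show ?thesis
  proof (rule maximum_modulus_frontier[where f = f and \<xi> = z and S = "cball c r"])
    show "f holomorphic_on interior (cball c r)"
      using f by (rule holomorphic_on_subset) simp
    show "continuous_on (closure (cball c r)) f"
      using f by (intro holomorphic_on_imp_continuous_on holomorphic_on_subset[OF f]) simp
    show "norm (f w) \<le> B" if "w \<in> frontier (cball c r)" for w
      using that B True by simp
  qed (use z in auto)
next
  case False
  then have "z \<in> sphere c r" using z zero_le_dist[of c z] by (simp del: zero_le_dist)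
  then show ?thesis by (rule B)
qed

text \<open>This is Harnack's inequality for the positive harmonic function \<open>- ln \<bar>v\<bar>\<close>, whose value
  at distance half the radius is at most \<open>(1 + 1/2) / (1 - 1/2) = 3\<close> times the value at the centre.
  Writing \<open>v = exp g\<close>, the function \<open>g\<close> maps into the left half plane; a Moebius map takes that half
  plane to the unit disc and \<open>g 0\<close> to \<open>0\<close>, and the Schwarz lemma applies to the composition.\<close>

lemma harnack_nonvanishing:
  assumes hol: "v holomorphic_on ball 0 r" and r: "r > 0"
    and nz: "\<And>z. z \<in> ball 0 r \<Longrightarrow> v z \<noteq> 0"
    and less: "\<And>z. z \<in> ball 0 r \<Longrightarrow> norm (v z) < 1"
    and z: "norm z \<le> r / 2"
  shows "norm (v 0) ^ 3 \<le> norm (v z)"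
proof -
  obtain g where g: "g holomorphic_on ball 0 r" and vg: "\<And>w. w \<in> ball 0 r \<Longrightarrow> v w = exp (g w)"
    using contractible_imp_holomorphic_log[OF hol _ nz] convex_imp_contractible[OF convex_ball] by metis
  have neg: "Re (g w) < 0" if "w \<in> ball 0 r" for w
    using less[OF that] vg[OF that] by simp
  have in_ball: "of_real r * w \<in> ball 0 r" if "w \<in> ball 0 1" for w :: complex
    using that r by (simp add: norm_mult)
  have neg0: "Re (g 0) < 0" using neg r by simp
  define k where "k w = (g (of_real r * w) - g 0) / (g (of_real r * w) + cnj (g 0))" for w
  have den: "g (of_real r * w) + cnj (g 0) \<noteq> 0" if "w \<in> ball 0 1" for w
    using neg[OF in_ball[OF that]] neg0 by (auto simp: complex_eq_iff)
  have comp: "(\<lambda>w. g (of_real r * w)) holomorphic_on ball 0 1"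
    using holomorphic_on_compose_gen[OF _ g, of "\<lambda>w. of_real r * w" "ball 0 1"] in_ball
    by (force simp: o_def intro!: holomorphic_intros)
  have holk: "k holomorphic_on ball 0 1"
    unfolding k_def using comp den by (intro holomorphic_intros) auto
  have k1: "norm (k w) < 1" if "norm w < 1" for w
  proof -
    let ?a = "g (of_real r * w)"
    have a: "Re ?a < 0" using neg[OF in_ball] that by simp
    have "(norm (?a + cnj (g 0)))\<^sup>2 - (norm (?a - g 0))\<^sup>2 = 4 * (Re ?a * Re (g 0))"
      unfolding cmod_power2 by (simp add: power2_eq_square algebra_simps)
    then have "(norm (?a - g 0))\<^sup>2 < (norm (?a + cnj (g 0)))\<^sup>2"
      using mult_neg_neg[OF a neg0] by simp
    then have "norm (?a - g 0) < norm (?a + cnj (g 0))"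
      by (rule power_less_imp_less_base) simp
    then show ?thesis
      unfolding k_def norm_divide using den that by (simp add: divide_less_eq)
  qed
  have z1: "norm (z / of_real r) \<le> 1 / 2"
    using z r by (simp add: norm_divide divide_le_eq)
  then have "norm (k (z / of_real r)) \<le> 1 / 2"
    using Schwarz_Lemma(1)[OF holk _ k1, of "z / of_real r"] by (simp add: k_def)
  then have le: "2 * norm (g z - g 0) \<le> norm (g z + cnj (g 0))"
    using den[of "z / of_real r"] r z1
    by (simp add: k_def norm_divide field_simps)
  have zb: "z \<in> ball 0 r" using z r by simp
  define A B y where "A = - Re (g z)" and "B = - Re (g 0)" and "y = Im (g z) - Im (g 0)"
  \<comment> \<open>The imaginary parts enter both sides only through \<open>y\<close>, with the larger weight on the
    left; dropping them leaves an inequality between real parts.\<close>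
  have "4 * (norm (g z - g 0))\<^sup>2 \<le> (norm (g z + cnj (g 0)))\<^sup>2"
    using power_mono[OF le, of 2] by (simp add: power_mult_distrib)
  then have "4 * ((A - B)\<^sup>2 + y\<^sup>2) \<le> (A + B)\<^sup>2 + y\<^sup>2"
    unfolding cmod_power2 by (simp add: A_def B_def y_def power2_eq_square algebra_simps)
  moreover have "4 * a \<le> b" if "4 * (a + s) \<le> b + s" "s \<ge> 0" for a b s :: real
    using that by simp
  ultimately have "4 * (A - B)\<^sup>2 \<le> (A + B)\<^sup>2" using zero_le_power2 by blast
  then have "(2 * (A - B))\<^sup>2 \<le> (A + B)\<^sup>2" unfolding power_mult_distrib by simp
  moreover have "A + B \<ge> 0" using neg[OF zb] neg0 by (simp add: A_def B_def)
  ultimately have "2 * (A - B) \<le> A + B" by (rule power2_le_imp_le)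
  then have "3 * Re (g 0) \<le> Re (g z)" by (simp add: A_def B_def)
  then have "exp (3 * Re (g 0)) \<le> exp (Re (g z))" by simp
  then show ?thesis
    using vg[OF zb] vg[of 0] r by (simp add: exp_of_nat_mult[symmetric])
qed

text \<open>Dividing out Blaschke factors keeps the modulus on the unit circle. Each zero removed has modulus
  below \<open>1/2\<close>, so each removal at least doubles the modulus at \<open>0\<close>, which the maximum principle bounds
  by \<open>B\<close>. The process therefore stops.\<close>

lemma remove_zeros_near_0:
  assumes q: "q holomorphic_on UNIV" and B: "\<And>z. norm z = 1 \<Longrightarrow> norm (q z) \<le> B"
    and q0: "q 0 \<noteq> 0"
  shows "\<exists>u. u holomorphic_on UNIV \<and> (\<forall>z. norm z < 1/2 \<longrightarrow> u z \<noteq> 0) \<and>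
    (\<forall>z. norm z = 1 \<longrightarrow> norm (u z) = norm (q z)) \<and> norm (q 0) \<le> norm (u 0)"
proof -
  have main: "\<exists>u. u holomorphic_on UNIV \<and> (\<forall>z. norm z < 1/2 \<longrightarrow> u z \<noteq> 0) \<and>
          (\<forall>z. norm z = 1 \<longrightarrow> norm (u z) = norm (q z)) \<and> norm (q 0) \<le> norm (u 0)"
    if "q holomorphic_on UNIV" "\<forall>z. norm z = 1 \<longrightarrow> norm (q z) \<le> B" "q 0 \<noteq> 0" "B < 2 ^ n * norm (q 0)"
    for q and n :: nat
    using that
  proof (induction n arbitrary: q)
    case 0
    have "norm (q 0) \<le> B"
      by (rule ball_modulus_bound[where c=0 and r=1]) (use 0 in auto)
    then show ?case using 0 by simp
  next
    case (Suc n)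
    show ?case
    proof (cases "\<exists>a. norm a < 1/2 \<and> q a = 0")
      case False
      then show ?thesis using Suc.prems by blast
    next
      case True
      then obtain a where a: "norm a < 1/2" "q a = 0" by blast
      have a0: "a \<noteq> 0" using a Suc.prems by auto
      define q1 where "q1 z = (if z = a then deriv q a else (q z - q a) / (z - a))" for z
      \<comment> \<open>\<open>q2\<close> is \<open>q\<close> divided by the Blaschke factor \<open>(z - a) / (1 - cnj a * z)\<close>; it is again entire.\<close>
      define q2 where "q2 z = (1 - cnj a * z) * q1 z" for z
      have q1: "q1 holomorphic_on UNIV"
        unfolding q1_def by (rule pole_lemma) (use Suc.prems in auto)
      have hol: "q2 holomorphic_on UNIV"
        unfolding q2_def using q1 by (intro holomorphic_intros)
      have sph: "norm (q2 z) = norm (q z)" if z: "norm z = 1" for z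
      proof -
        have "z * cnj z = 1" using z by (simp add: complex_norm_square[symmetric])
        then have "1 - cnj a * z = z * cnj (z - a)" by (simp add: algebra_simps)
        then have "norm (1 - cnj a * z) = norm (z - a)" using z
          by (simp only: norm_mult complex_mod_cnj)
        moreover have "z \<noteq> a" using a z by auto
        ultimately show ?thesis by (simp add: q2_def q1_def a norm_mult norm_divide)
      qed
      have q20: "q2 0 = - q 0 / a" using a0 a by (simp add: q2_def q1_def)
      have big: "2 * norm (q 0) \<le> norm (q2 0)"
        using a a0 mult_right_mono[of "2 * norm a" 1 "norm (q 0)"]
        by (simp add: q20 norm_divide le_divide_eq mult_ac)
      have "B < 2 ^ n * norm (q2 0)"
      proof -
        have "2 ^ n * (2 * norm (q 0)) \<le> 2 ^ n * norm (q2 0)"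
          using big by (rule mult_left_mono) simp
        then show ?thesis using Suc.prems(4) by (simp only: power_Suc2 mult.assoc)
      qed
      then obtain u where u: "u holomorphic_on UNIV" "\<forall>z. norm z < 1/2 \<longrightarrow> u z \<noteq> 0"
          "\<forall>z. norm z = 1 \<longrightarrow> norm (u z) = norm (q2 z)" "norm (q2 0) \<le> norm (u 0)"
        using Suc.IH[OF hol] sph Suc.prems a0 q20 by auto
      moreover have "norm (q 0) \<le> norm (q2 0)" using big norm_ge_zero[of "q 0"] by linarith
      ultimately show ?thesis using sph order_trans by (intro exI[of _ u]) auto
    qed
  qed
  obtain n :: nat where "B / norm (q 0) < 2 ^ n" using real_arch_pow[of 2] by auto
  then have "B < 2 ^ n * norm (q 0)" using q0 by (simp add: divide_less_eq)
  then show ?thesis using q B q0 by (intro main) auto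
qed

text \<open>Let \<open>u\<close> be \<open>q\<close> with its zeros near \<open>0\<close> removed. By the maximum principle, \<open>\<bar>f u\<bar> \<le> H\<close> on the
  disc, because \<open>\<bar>u\<bar> = \<bar>q\<bar>\<close> on the circle; and Harnack's inequality for \<open>u / B\<close> bounds \<open>\<bar>u\<bar>\<close> from below
  on the smaller disc.\<close>

lemma quotient_bound_unit_disc:
  assumes f: "f holomorphic_on UNIV" and q: "q holomorphic_on UNIV" and q0: "q 0 \<noteq> 0"
    and H: "\<And>z. norm z = 1 \<Longrightarrow> norm (f z * q z) \<le> H"
    and B: "\<And>z. norm z = 1 \<Longrightarrow> norm (q z) < B"
    and z: "norm z \<le> 1/4"
  shows "norm (f z) \<le> H * B\<^sup>2 / norm (q 0) ^ 3"
proof -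
  obtain u where u: "u holomorphic_on UNIV" "\<And>z. norm z < 1/2 \<Longrightarrow> u z \<noteq> 0"
    "\<And>z. norm z = 1 \<Longrightarrow> norm (u z) = norm (q z)" "norm (q 0) \<le> norm (u 0)"
    using remove_zeros_near_0[OF q less_imp_le[OF B] q0] by blast
  \<comment> \<open>The maximum over the circle is attained, so there is room for a strict inequality
    inside the disc, as the logarithm in Harnack's inequality requires.\<close>
  obtain B' where B': "B' < B" "\<And>z. norm z = 1 \<Longrightarrow> norm (q z) \<le> B'"
  proof -
    have "continuous_on (sphere 0 1) (\<lambda>z. norm (q z))"
      using q holomorphic_on_imp_continuous_on holomorphic_on_subset by (intro continuous_on_norm) blast
    then obtain w where "w \<in> sphere 0 1" "\<And>z. z \<in> sphere 0 1 \<Longrightarrow> norm (q z) \<le> norm (q w)"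
      using continuous_attains_sup[of "sphere (0::complex) 1" "\<lambda>z. norm (q z)"] by auto
    then show ?thesis using B that by auto
  qed
  have uB: "norm (u w) < B" if "norm w \<le> 1" for w
    using ball_modulus_bound[OF u(1), of 0 1 B' w] that B' u(3) by fastforce
  have Bpos: "B > 0" using uB[of 0] norm_ge_zero[of "u 0"] by (simp del: norm_ge_zero)
  have fu: "norm (f z * u z) \<le> H"
  proof (rule ball_modulus_bound[where f="\<lambda>z. f z * u z" and z=z and c=0 and r=1])
    show "(\<lambda>z. f z * u z) holomorphic_on UNIV" using f u by (intro holomorphic_intros)
    show "norm (f w * u w) \<le> H" if "w \<in> sphere 0 1" for w
      using that H u(3) by (simp add: norm_mult)
  qed (use z in auto)
  have "norm (u 0 / of_real B) ^ 3 \<le> norm (u z / of_real B)"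
  proof (rule harnack_nonvanishing[where r="1/2"])
    show "(\<lambda>z. u z / of_real B) holomorphic_on ball 0 (1/2)"
      using u(1) Bpos by (intro holomorphic_intros) (auto intro: holomorphic_on_subset)
    show "norm (u w / of_real B) < 1" if "w \<in> ball 0 (1/2)" for w
      using uB[of w] Bpos that by (simp add: norm_divide)
  qed (use z u Bpos in auto)
  then have "norm (u 0) ^ 3 \<le> norm (u z) * B\<^sup>2"
    using Bpos by (simp add: norm_divide power_divide field_simps power2_eq_square power3_eq_cube)
  moreover have "norm (q 0) ^ 3 \<le> norm (u 0) ^ 3" using u(4) by (rule power_mono) simp
  ultimately have "norm (q 0) ^ 3 \<le> norm (u z) * B\<^sup>2" by linarith
  then have "norm (f z) * norm (q 0) ^ 3 \<le> norm (f z) * (norm (u z) * B\<^sup>2)"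
    by (rule mult_left_mono) simp
  also have "\<dots> \<le> H * B\<^sup>2"
    using mult_right_mono[OF fu, of "B\<^sup>2"] by (simp add: norm_mult mult_ac)
  finally show ?thesis using q0 by (simp add: le_divide_eq)
qed

lemma quotient_bound:
  assumes f: "f holomorphic_on UNIV" and q: "q holomorphic_on UNIV" and qc: "q c \<noteq> 0" and r: "r > 0"
    and H: "\<And>z. z \<in> sphere c (4 * r) \<Longrightarrow> norm (f z * q z) \<le> H"
    and B: "\<And>z. z \<in> sphere c (4 * r) \<Longrightarrow> norm (q z) < B"
    and z: "z \<in> cball c r"
  shows "norm (f z) \<le> H * B\<^sup>2 / norm (q c) ^ 3"
proof -
  define T where "T w = c + of_real (4 * r) * w" for w
  have T: "T holomorphic_on UNIV" unfolding T_def by (intro holomorphic_intros)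
  have comp: "(\<lambda>w. p (T w)) holomorphic_on UNIV" if "p holomorphic_on UNIV" for p
    using holomorphic_on_compose_gen[OF T that] by (simp add: o_def)
  have sph: "T w \<in> sphere c (4 * r)" if "norm w = 1" for w
    using that r by (simp add: T_def dist_norm norm_mult)
  have "norm (f (T ((z - c) / of_real (4 * r)))) \<le> H * B\<^sup>2 / norm (q (T 0)) ^ 3"
  proof (rule quotient_bound_unit_disc[of "\<lambda>w. f (T w)" "\<lambda>w. q (T w)"])
    show "norm ((z - c) / complex_of_real (4 * r)) \<le> 1 / 4"
      using z r by (simp add: dist_norm norm_divide norm_minus_commute divide_le_eq)
  qed (use comp f q qc H B sph in \<open>auto simp: T_def\<close>)
  then show ?thesis using r by (simp add: T_def)
qed

section \<open>Entire functions of growth order below a bound\<close>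

text \<open>A strict upper bound on the order leaves room between exponents: a larger exponent turns the
  weak pointwise inequality into the strict one in the definition of the order.\<close>

lemma growth_order_less_iff:
  assumes f: "continuous_on UNIV f"
  shows "growth_order f < \<beta> \<longleftrightarrow>
    (\<exists>\<alpha>>0. ereal \<alpha> < \<beta> \<and> (\<forall>\<^sub>F z in at_infinity. norm (f z) \<le> exp (norm z powr \<alpha>)))"
proof
  assume "growth_order f < \<beta>"
  then obtain \<alpha> r0 where \<alpha>: "\<alpha> > 0" "ereal \<alpha> < \<beta>"
    and r0: "\<forall>r>r0. max_modulus f r < exp (r powr \<alpha>)"
    unfolding growth_order_def Inf_less_iff by blast
  have "norm (f z) \<le> exp (norm z powr \<alpha>)" if "norm z \<ge> r0 + 1" for z
  proof -
    have "compact ((\<lambda>z. norm (f z)) ` sphere 0 (norm z))"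
      using f by (intro compact_continuous_image continuous_on_norm) (auto intro: continuous_on_subset)
    then have "norm (f z) \<le> max_modulus f (norm z)"
      unfolding max_modulus_def
      by (intro cSUP_upper bounded_imp_bdd_above compact_imp_bounded) auto
    also have "\<dots> < exp (norm z powr \<alpha>)" using r0 that by auto
    finally show ?thesis by simp
  qed
  then show "\<exists>\<alpha>>0. ereal \<alpha> < \<beta> \<and> (\<forall>\<^sub>F z in at_infinity. norm (f z) \<le> exp (norm z powr \<alpha>))"
    using \<alpha> by (auto simp: eventually_at_infinity)
next
  assume "\<exists>\<alpha>>0. ereal \<alpha> < \<beta> \<and> (\<forall>\<^sub>F z in at_infinity. norm (f z) \<le> exp (norm z powr \<alpha>))"
  then obtain \<alpha> b where \<alpha>: "\<alpha> > 0" "ereal \<alpha> < \<beta>"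
    and b: "\<And>z. b \<le> norm z \<Longrightarrow> norm (f z) \<le> exp (norm z powr \<alpha>)"
    by (auto simp: eventually_at_infinity)
  obtain \<alpha>' where \<alpha>': "\<alpha> < \<alpha>'" "ereal \<alpha>' < \<beta>"
    using ereal_dense2[OF \<alpha>(2)] by auto
  have "max_modulus f r < exp (r powr \<alpha>')" if r: "r > max b 1" for r
  proof -
    have "max_modulus f r \<le> exp (r powr \<alpha>)"
      unfolding max_modulus_def
    proof (rule cSUP_least)
      show "sphere (0::complex) r \<noteq> {}" using r by simp
    qed (use b r in auto)
    also have "\<dots> < exp (r powr \<alpha>')" using r \<alpha>' by (simp add: powr_less_mono)
    finally show ?thesis .
  qed
  then have "ereal \<alpha>' \<in> {ereal \<alpha> | \<alpha>. \<alpha> > 0 \<and> (\<exists>r\<^sub>0>0. \<forall>r>r\<^sub>0. max_modulus f r < exp (r powr \<alpha>))}"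
    using \<alpha> \<alpha>' by (auto intro!: exI[of _ "max b 1"])
  then have "growth_order f \<le> ereal \<alpha>'" unfolding growth_order_def by (rule Inf_lower)
  then show "growth_order f < \<beta>" using \<alpha>'(2) by (rule le_less_trans)
qed

lemma growth_order_nonneg: "growth_order f \<ge> 0"
  unfolding growth_order_def by (rule Inf_greatest) auto

text \<open>Passing to a slightly larger exponent swallows all multiplicative constants, inside and outside
  the exponential; this is why orders below a bound are closed under algebraic operations.\<close>

lemma eventually_exp_powr_absorbs:
  fixes \<alpha> \<alpha>' C K :: real
  assumes "0 < \<alpha>" "\<alpha> < \<alpha>'"
  shows "\<forall>\<^sub>F z::complex in at_infinity. C * exp (K * norm z powr \<alpha>) \<le> exp (norm z powr \<alpha>')"
proof -
  have lim: "filterlim (\<lambda>r::real. r powr (\<alpha>' - \<alpha>)) at_top at_top" "filterlim (\<lambda>r::real. r powr \<alpha>) at_top at_top"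
    using assms by real_asymp+
  have "\<forall>\<^sub>F r::real in at_top. C * exp (K * r powr \<alpha>) \<le> exp (r powr \<alpha>')"
    using filterlim_at_top_dense[THEN iffD1, OF lim(1), rule_format, of "K + 1"]
      filterlim_at_top_dense[THEN iffD1, OF lim(2), rule_format, of "ln (max C 1)"]
      eventually_gt_at_top[of 0]
  proof eventually_elim
    case (elim r)
    have "C \<le> exp (ln (max C 1))" by simp
    also have "\<dots> \<le> exp (r powr \<alpha>)" using elim(2) by (simp only: exp_le_cancel_iff less_imp_le)
    finally have "C * exp (K * r powr \<alpha>) \<le> exp (r powr \<alpha>) * exp (K * r powr \<alpha>)"
      by (rule mult_right_mono) simp
    also have "\<dots> = exp ((K + 1) * r powr \<alpha>)" by (simp add: exp_add[symmetric] algebra_simps)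
    also have "\<dots> \<le> exp (r powr (\<alpha>' - \<alpha>) * r powr \<alpha>)"
      using elim by (simp add: mult_right_mono)
    also have "r powr (\<alpha>' - \<alpha>) * r powr \<alpha> = r powr \<alpha>'" by (simp add: powr_add[symmetric])
    finally show ?case .
  qed
  then show ?thesis
    using filterlim_at_infinity_imp_norm_at_top[OF filterlim_ident] by (rule eventually_compose_filterlim)
qed

text \<open>Constants are admitted separately so that the class is closed under the algebraic operations
  for every bound. For \<open>\<beta> > 0\<close> they have order below \<open>\<beta>\<close> anyway; for \<open>\<beta> = 0\<close>, where no function
  has order below \<open>\<beta>\<close>, they are the whole class. A non-constant function of order \<open>\<beta>\<close>
  is never slow for \<open>\<beta>\<close>.\<close>

definition slow :: "ereal \<Rightarrow> (complex \<Rightarrow> complex) \<Rightarrow> bool" where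
  "slow \<beta> f \<longleftrightarrow> f holomorphic_on UNIV \<and> (f constant_on UNIV \<or> growth_order f < \<beta>)"

lemma slow_nonpos_iff:
  assumes "\<beta> \<le> 0"
  shows "slow \<beta> f \<longleftrightarrow> f constant_on UNIV"
proof -
  have "\<not> growth_order f < \<beta>" using assms growth_order_nonneg[of f] by (simp add: not_less)
  moreover have "f holomorphic_on UNIV" if "f constant_on UNIV"
    using that by (metis constant_on_def holomorphic_on_const holomorphic_transform)
  ultimately show ?thesis unfolding slow_def by blast
qed

lemma slow_pos_iff:
  assumes \<beta>: "\<beta> > 0"
  shows "slow \<beta> f \<longleftrightarrow> f holomorphic_on UNIV \<and>
    (\<exists>\<alpha>>0. ereal \<alpha> < \<beta> \<and> (\<forall>\<^sub>F z in at_infinity. norm (f z) \<le> exp (norm z powr \<alpha>)))"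
proof (cases "f holomorphic_on UNIV")
  case True
  have "growth_order f < \<beta>" if const: "f constant_on UNIV"
  proof -
    obtain C where C: "\<And>z. f z = C" using const by (auto simp: constant_on_def)
    obtain \<alpha> where \<alpha>: "0 < \<alpha>" "ereal \<alpha> < \<beta>"
      using ereal_dense2[of 0 \<beta>] \<beta> by auto
    have "\<forall>\<^sub>F z::complex in at_infinity. norm (f z) \<le> exp (norm z powr \<alpha>)"
      using eventually_exp_powr_absorbs[of "\<alpha> / 2" \<alpha> "norm C" 0] \<alpha> by (simp add: C)
    then show ?thesis
      using \<alpha> True by (auto simp: growth_order_less_iff holomorphic_on_imp_continuous_on)
  qed
  then have "slow \<beta> f \<longleftrightarrow> growth_order f < \<beta>" using True unfolding slow_def by blast
  then show ?thesis
    using True by (simp add: growth_order_less_iff holomorphic_on_imp_continuous_on)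
qed (simp add: slow_def)

lemma slow_common_exponent:
  assumes \<beta>: "\<beta> > 0" and I: "finite I" and "\<And>i. i \<in> I \<Longrightarrow> slow \<beta> (c i)"
  shows "\<exists>\<alpha>>0. ereal \<alpha> < \<beta> \<and> (\<forall>\<^sub>F z in at_infinity. \<forall>i\<in>I. norm (c i z) \<le> exp (norm z powr \<alpha>))"
  using I assms(3)
proof (induction I)
  case empty
  then show ?case using ereal_dense2[of 0 \<beta>] \<beta> by auto
next
  case (insert j I)
  obtain \<alpha> where \<alpha>: "\<alpha> > 0" "ereal \<alpha> < \<beta>"
      "\<forall>\<^sub>F z in at_infinity. \<forall>i\<in>I. norm (c i z) \<le> exp (norm z powr \<alpha>)"
    using insert by auto
  obtain \<alpha>j where \<alpha>j: "\<alpha>j > 0" "ereal \<alpha>j < \<beta>"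
      "\<forall>\<^sub>F z in at_infinity. norm (c j z) \<le> exp (norm z powr \<alpha>j)"
    using insert.prems[of j] slow_pos_iff[OF \<beta>] by auto
  have "\<forall>\<^sub>F z::complex in at_infinity. norm z \<ge> 1" by (auto simp: eventually_at_infinity)
  with \<alpha>(3) \<alpha>j(3)
  have "\<forall>\<^sub>F z in at_infinity. \<forall>i\<in>insert j I. norm (c i z) \<le> exp (norm z powr max \<alpha> \<alpha>j)"
  proof eventually_elim
    case (elim z)
    have "exp (norm z powr \<alpha>) \<le> exp (norm z powr max \<alpha> \<alpha>j)"
      "exp (norm z powr \<alpha>j) \<le> exp (norm z powr max \<alpha> \<alpha>j)"
      using elim by (simp_all add: powr_mono)
    then show ?case using elim by (auto intro: order_trans)
  qed
  then show ?case using \<alpha> \<alpha>j by (intro exI[of _ "max \<alpha> \<alpha>j"]) (auto simp: max_def)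
qed

text \<open>For \<open>\<beta> \<le> 0\<close> this is Liouville's theorem. It yields closure under sums, but it is stated with moduli
  because it is also applied to a function known only through an inequality.\<close>

lemma slow_of_dominated:
  assumes h: "h holomorphic_on UNIV" and I: "finite I" and slow: "\<And>i. i \<in> I \<Longrightarrow> slow \<beta> (c i)"
    and le: "\<And>z. norm (h z) \<le> (\<Sum>i\<in>I. norm (c i z))"
  shows "slow \<beta> h"
proof (cases "\<beta> > 0")
  case True
  obtain \<alpha> where \<alpha>: "\<alpha> > 0" "ereal \<alpha> < \<beta>"
      "\<forall>\<^sub>F z in at_infinity. \<forall>i\<in>I. norm (c i z) \<le> exp (norm z powr \<alpha>)"
    using slow_common_exponent[where c = c, OF True I slow] by auto
  obtain \<alpha>' where \<alpha>': "\<alpha> < \<alpha>'" "ereal \<alpha>' < \<beta>"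
    using ereal_dense2[OF \<alpha>(2)] by auto
  have "\<forall>\<^sub>F z in at_infinity. norm (h z) \<le> exp (norm z powr \<alpha>')"
    using \<alpha>(3) eventually_exp_powr_absorbs[OF \<alpha>(1) \<alpha>'(1), of "card I" 1]
  proof eventually_elim
    case (elim z)
    have "norm (h z) \<le> card I * exp (norm z powr \<alpha>)"
      using le[of z] sum_bounded_above[of I "\<lambda>i. norm (c i z)" "exp (norm z powr \<alpha>)"] elim(1) by auto
    then show ?case using elim(2) by simp
  qed
  then show ?thesis
    using h \<alpha> \<alpha>' slow_pos_iff[OF True] by (auto intro!: exI[of _ \<alpha>'])
next
  case False
  then have np: "\<beta> \<le> 0" by simp
  have const: "norm (c i z) = norm (c i 0)" if "i \<in> I" for i z
    using slow[OF that] unfolding slow_nonpos_iff[OF np] by (auto simp: constant_on_def)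
  have "(\<Sum>i\<in>I. norm (c i z)) = (\<Sum>i\<in>I. norm (c i 0))" for z
    using const by (rule sum.cong[OF refl])
  then have "norm (h z) \<le> (\<Sum>i\<in>I. norm (c i 0))" for z
    using le[of z] by metis
  then have "bounded (h ` UNIV)" unfolding bounded_iff by blast
  then show ?thesis using Liouville_theorem[OF h] slow_nonpos_iff[OF np] by simp
qed

lemma slow_const: "slow \<beta> (\<lambda>z. a)"
  by (auto simp: slow_def constant_on_def)

lemma slow_mult:
  assumes f: "slow \<beta> f" and g: "slow \<beta> g"
  shows "slow \<beta> (\<lambda>z. f z * g z)"
proof (cases "\<beta> > 0")
  case True
  obtain \<alpha> where \<alpha>: "\<alpha> > 0" "ereal \<alpha> < \<beta>"
      "\<forall>\<^sub>F z in at_infinity. \<forall>p\<in>{f, g}. norm (p z) \<le> exp (norm z powr \<alpha>)"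
    using slow_common_exponent[OF True, where I = "{f, g}" and c = "\<lambda>p. p"] f g by auto
  obtain \<alpha>' where \<alpha>': "\<alpha> < \<alpha>'" "ereal \<alpha>' < \<beta>"
    using ereal_dense2[OF \<alpha>(2)] by auto
  have "\<forall>\<^sub>F z in at_infinity. norm (f z * g z) \<le> exp (norm z powr \<alpha>')"
    using \<alpha>(3) eventually_exp_powr_absorbs[OF \<alpha>(1) \<alpha>'(1), of 1 2]
  proof eventually_elim
    case (elim z)
    have "norm (f z * g z) \<le> exp (norm z powr \<alpha>) * exp (norm z powr \<alpha>)"
      unfolding norm_mult using elim(1) by (intro mult_mono) auto
    also have "\<dots> = exp (2 * norm z powr \<alpha>)" by (simp add: exp_add[symmetric])
    finally show ?case using elim(2) by (simp only: mult_1 order_trans)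
  qed
  moreover have "(\<lambda>z. f z * g z) holomorphic_on UNIV"
    using f g by (auto simp: slow_def intro!: holomorphic_intros)
  ultimately show ?thesis
    using \<alpha> \<alpha>' slow_pos_iff[OF True] by (auto intro!: exI[of _ \<alpha>'])
next
  case False
  then have "\<beta> \<le> 0" by simp
  then show ?thesis using f g by (auto simp: slow_nonpos_iff constant_on_def)
qed

lemma slow_power:
  assumes "slow \<beta> f"
  shows "slow \<beta> (\<lambda>z. f z ^ n)"
proof (induction n)
  case (Suc n)
  show ?case unfolding power_Suc using assms Suc by (rule slow_mult)
qed (simp add: slow_const)

lemma slow_prod:
  assumes "finite I" "\<And>i. i \<in> I \<Longrightarrow> slow \<beta> (c i)"
  shows "slow \<beta> (\<lambda>z. \<Prod>i\<in>I. c i z)"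
  using assms
proof (induction I)
  case (insert j I)
  have "slow \<beta> (\<lambda>z. c j z * (\<Prod>i\<in>I. c i z))" using insert by (intro slow_mult) auto
  then show ?case using insert by simp
qed (simp add: slow_const)

text \<open>The analytic core: if an entire function is a quotient, its order is at most the larger of the
  orders of numerator and denominator. At a point \<open>z\<close> with \<open>\<bar>z\<bar> \<ge> \<bar>c\<bar>\<close>, the bound for quotients is applied
  on the disc of centre \<open>c\<close> and radius \<open>8 \<bar>z\<bar>\<close>; its boundary lies between the moduli \<open>7 \<bar>z\<bar>\<close> and
  \<open>9 \<bar>z\<bar>\<close>, where, for large \<open>\<bar>z\<bar>\<close>, both given functions are at most \<open>exp ((9 \<bar>z\<bar>) powr \<alpha>)\<close>.\<close>

lemma slow_quotient:
  assumes f: "f holomorphic_on UNIV" and q: "slow \<beta> q" and fq: "slow \<beta> (\<lambda>z. f z * q z)"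
    and c: "q c \<noteq> 0"
  shows "slow \<beta> f"
proof (cases "\<beta> > 0")
  case True
  obtain \<alpha> where \<alpha>: "\<alpha> > 0" "ereal \<alpha> < \<beta>"
      "\<forall>\<^sub>F z in at_infinity. \<forall>p\<in>{q, \<lambda>z. f z * q z}. norm (p z) \<le> exp (norm z powr \<alpha>)"
    using slow_common_exponent[OF True, where I = "{q, \<lambda>z. f z * q z}" and c = "\<lambda>p. p"] q fq by auto
  obtain b where b: "\<And>z. norm z \<ge> b \<Longrightarrow> norm (q z) \<le> exp (norm z powr \<alpha>)"
      "\<And>z. norm z \<ge> b \<Longrightarrow> norm (f z * q z) \<le> exp (norm z powr \<alpha>)"
    using \<alpha>(3) by (auto simp: eventually_at_infinity)
  obtain \<alpha>' where \<alpha>': "\<alpha> < \<alpha>'" "ereal \<alpha>' < \<beta>"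
    using ereal_dense2[OF \<alpha>(2)] by auto
  have "\<forall>\<^sub>F z::complex in at_infinity. norm z \<ge> max (max b (norm c)) 1"
    unfolding eventually_at_infinity by blast
  then have "\<forall>\<^sub>F z in at_infinity. norm (f z) \<le> exp (norm z powr \<alpha>')"
    using eventually_exp_powr_absorbs[OF \<alpha>(1) \<alpha>'(1), of "4 / norm (q c) ^ 3" "3 * 9 powr \<alpha>"]
  proof eventually_elim
    case (elim z)
    define E where "E = exp ((9 * norm z) powr \<alpha>)"
    have sph: "b \<le> norm w \<and> exp (norm w powr \<alpha>) \<le> E" if "w \<in> sphere c (4 * (2 * norm z))" for w
    proof -
      have w: "norm (w - c) = 8 * norm z" using that by (simp add: dist_norm norm_minus_commute)
      have "norm (w - c) \<le> norm w + norm c" "norm w \<le> norm (w - c) + norm c"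
        by (rule norm_triangle_ineq4, metis diff_add_cancel norm_triangle_ineq)
      then have "b \<le> norm w" "norm w \<le> 9 * norm z" using w elim(1) by auto
      then show ?thesis using \<alpha>(1) by (simp add: E_def powr_mono2)
    qed
    have "norm (f z) \<le> E * (2 * E)\<^sup>2 / norm (q c) ^ 3"
    proof (rule quotient_bound[where f = f and q = q and c = c and z = z and r = "2 * norm z"])
      show "norm (f w * q w) \<le> E" if "w \<in> sphere c (4 * (2 * norm z))" for w
        using sph[OF that] b(2)[of w] by linarith
      show "norm (q w) < 2 * E" if "w \<in> sphere c (4 * (2 * norm z))" for w
        using sph[OF that] b(1)[of w] exp_gt_zero[of "(9 * norm z) powr \<alpha>"] unfolding E_def by linarith
      show "z \<in> cball c (2 * norm z)"
        using norm_triangle_ineq4[of c z] elim(1) by (simp add: dist_norm)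
    qed (use f c q elim(1) in \<open>auto simp: slow_def\<close>)
    also have "\<dots> = 4 / norm (q c) ^ 3 * E ^ 3" by (simp add: power2_eq_square power3_eq_cube)
    also have "E ^ 3 = exp (3 * 9 powr \<alpha> * norm z powr \<alpha>)"
      by (simp add: E_def exp_of_nat_mult[symmetric] powr_mult)
    finally show ?case using elim(2) by linarith
  qed
  then show ?thesis
    using f \<alpha> \<alpha>' slow_pos_iff[OF True] by (auto intro!: exI[of _ \<alpha>'])
next
  case False
  then have np: "\<beta> \<le> 0" by simp
  obtain a b where "\<And>z. q z = a" "\<And>z. f z * q z = b"
    using q fq by (auto simp: slow_nonpos_iff[OF np] constant_on_def)
  then have "f z = b / a" for z using c by (metis nonzero_mult_div_cancel_right)
  then show ?thesis by (auto simp: slow_nonpos_iff[OF np] constant_on_def)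
qed

section \<open>Polynomials as polynomials in one of their variables\<close>

text \<open>A number \<open>x\<close> with \<open>\<Sum>j\<le>d. q j * x ^ j = g\<close> need not be bounded in terms of \<open>g\<close> and the coefficients,
  since \<open>q d\<close> may be small, but \<open>q d * x\<close> is. For \<open>\<bar>x\<bar> > 1\<close> the equation is solved for \<open>q d * x ^ d\<close> and
  divided by \<open>x ^ (d - 1)\<close>.\<close>

lemma leading_term_bound:
  fixes q :: "nat \<Rightarrow> complex"
  assumes d: "d \<ge> 1"
  shows "norm (q d * x) \<le> norm (\<Sum>j\<le>d. q j * x ^ j) + (\<Sum>j\<le>d. norm (q j))"
proof (cases "norm x \<le> 1")
  case True
  have "norm (q d * x) \<le> norm (q d)"
    using True mult_left_mono[of "norm x" 1 "norm (q d)"] by (simp add: norm_mult)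
  also have "\<dots> \<le> (\<Sum>j\<le>d. norm (q j))" by (rule member_le_sum) auto
  finally show ?thesis using norm_ge_zero[of "\<Sum>j\<le>d. q j * x ^ j"] by linarith
next
  case False
  define e where "e = d - 1"
  have d': "d = Suc e" using d by (simp add: e_def)
  define g where "g = (\<Sum>j\<le>d. q j * x ^ j)"
  have pow: "norm (x ^ j) \<le> norm (x ^ e)" if "j \<le> e" for j
    using that False by (simp add: norm_power power_increasing)
  have pe: "norm (x ^ e) \<ge> 1" using pow[of 0] by simp
  have "q d * x * x ^ e = g - (\<Sum>j\<le>e. q j * x ^ j)" by (simp add: g_def d' mult_ac)
  then have "norm (q d * x) * norm (x ^ e) \<le> norm g + norm (\<Sum>j\<le>e. q j * x ^ j)"
    by (metis norm_mult norm_triangle_ineq4)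
  also have "norm (\<Sum>j\<le>e. q j * x ^ j) \<le> (\<Sum>j\<le>e. norm (q j) * norm (x ^ e))"
  proof (rule sum_norm_le)
    show "norm (q j * x ^ j) \<le> norm (q j) * norm (x ^ e)" if "j \<in> {..e}" for j
      unfolding norm_mult using pow[of j] that by (simp add: mult_left_mono)
  qed
  also have "\<dots> = (\<Sum>j\<le>e. norm (q j)) * norm (x ^ e)" by (simp add: sum_distrib_right)
  also have "norm g \<le> norm g * norm (x ^ e)"
    using mult_left_mono[OF pe, of "norm g"] by simp
  finally have "norm (q d * x) * norm (x ^ e) \<le> (norm g + (\<Sum>j\<le>e. norm (q j))) * norm (x ^ e)"
    by (simp add: algebra_simps)
  moreover have "norm (x ^ e) > 0" using pe by linarith
  ultimately have "norm (q d * x) \<le> norm g + (\<Sum>j\<le>e. norm (q j))"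
    by (rule mult_right_le_imp_le)
  also have "(\<Sum>j\<le>e. norm (q j)) \<le> (\<Sum>j\<le>d. norm (q j))" by (simp add: d')
  finally show ?thesis by (simp add: g_def)
qed

text \<open>The coefficient of \<open>z\<^sub>N ^ j\<close> when the polynomial is read as a polynomial in \<open>z\<^sub>N\<close>
  over the polynomials in the other variables.\<close>

lift_definition coeff_of_var_power :: "nat \<Rightarrow> nat \<Rightarrow> cmpoly \<Rightarrow> cmpoly"
  is "\<lambda>N j p m. if Poly_Mapping.lookup m N = 0 then p (m + Poly_Mapping.single N j) else 0"
proof -
  fix N j :: nat and p :: "(nat \<Rightarrow>\<^sub>0 nat) \<Rightarrow> complex"
  assume "finite {m. p m \<noteq> 0}"
  then have "finite ((\<lambda>m. m + Poly_Mapping.single N j) -` {m. p m \<noteq> 0})"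
    by (rule finite_vimageI) (auto simp: inj_on_def)
  then show "finite {m. (if Poly_Mapping.lookup m N = 0 then p (m + Poly_Mapping.single N j) else 0) \<noteq> 0}"
    by (rule rev_finite_subset) auto
qed

lemma keys_coeff_of_var_power:
  "Poly_Mapping.keys (coeff_of_var_power N j P) =
     {m. Poly_Mapping.lookup m N = 0 \<and> m + Poly_Mapping.single N j \<in> Poly_Mapping.keys P}"
  by (auto simp: in_keys_iff coeff_of_var_power.rep_eq split: if_splits)

text \<open>This bijection reindexes the sum over the monomials of \<open>P\<close> by their exponent in \<open>z\<^sub>N\<close>, and its
  surjectivity shows that the leading coefficient is not \<open>0\<close>.\<close>

lemma bij_betw_keys_coeff_of_var_power:
  "bij_betw (\<lambda>m. m + Poly_Mapping.single N j) (Poly_Mapping.keys (coeff_of_var_power N j P))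
     {m \<in> Poly_Mapping.keys P. Poly_Mapping.lookup m N = j}"
proof -
  have "m \<in> (\<lambda>m. m + Poly_Mapping.single N j) ` Poly_Mapping.keys (coeff_of_var_power N j P)"
    if m: "m \<in> Poly_Mapping.keys P" "Poly_Mapping.lookup m N = j" for m
  proof
    show eq: "m = Poly_Mapping.update N 0 m + Poly_Mapping.single N j"
      using m by (intro poly_mapping_eqI) (auto simp: lookup_update lookup_add lookup_single when_def)
    show "Poly_Mapping.update N 0 m \<in> Poly_Mapping.keys (coeff_of_var_power N j P)"
      using m eq by (simp add: keys_coeff_of_var_power lookup_update)
  qed
  then show ?thesis
    by (auto simp: bij_betw_def inj_on_def keys_coeff_of_var_power lookup_add)
qed

lemma occurring_vars_coeff_of_var_power:
  "occurring_vars (coeff_of_var_power N j P) \<subseteq> occurring_vars P - {N}"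
proof
  fix k assume "k \<in> occurring_vars (coeff_of_var_power N j P)"
  then obtain m where m: "Poly_Mapping.lookup m N = 0" "m + Poly_Mapping.single N j \<in> Poly_Mapping.keys P"
      "k \<in> Poly_Mapping.keys m"
    by (auto simp: occurring_vars_def keys_coeff_of_var_power)
  then have "k \<noteq> N" "k \<in> Poly_Mapping.keys (m + Poly_Mapping.single N j)"
    by (auto simp: in_keys_iff lookup_add)
  then show "k \<in> occurring_vars P - {N}" using m(2) unfolding occurring_vars_def by blast
qed

lemma finite_occurring_vars: "finite (occurring_vars P)"
  unfolding occurring_vars_def by simp

text \<open>Both products are extended to one common finite set of variables, where the additional factors
  have exponent \<open>0\<close>.\<close>

lemma monomial_value_times_var_power:
  fixes a :: "nat \<Rightarrow> complex"
  shows "(\<Prod>k\<in>Poly_Mapping.keys (m + Poly_Mapping.single N j).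
            a k ^ Poly_Mapping.lookup (m + Poly_Mapping.single N j) k) =
         (\<Prod>k\<in>Poly_Mapping.keys m. a k ^ Poly_Mapping.lookup m k) * a N ^ j"
proof -
  let ?S = "insert N (Poly_Mapping.keys m)"
  have "(\<Prod>k\<in>Poly_Mapping.keys (m + Poly_Mapping.single N j).
            a k ^ Poly_Mapping.lookup (m + Poly_Mapping.single N j) k) =
        (\<Prod>k\<in>?S. a k ^ Poly_Mapping.lookup (m + Poly_Mapping.single N j) k)"
    by (rule prod.mono_neutral_left)
      (auto simp: in_keys_iff lookup_add lookup_single when_def split: if_splits)
  also have "\<dots> = (\<Prod>k\<in>?S. a k ^ Poly_Mapping.lookup m k * (if k = N then a N ^ j else 1))"
    by (rule prod.cong) (auto simp: lookup_add lookup_single when_def power_add)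
  also have "\<dots> = (\<Prod>k\<in>?S. a k ^ Poly_Mapping.lookup m k) * a N ^ j"
    by (simp add: prod.distrib prod.delta)
  also have "(\<Prod>k\<in>?S. a k ^ Poly_Mapping.lookup m k) = (\<Prod>k\<in>Poly_Mapping.keys m. a k ^ Poly_Mapping.lookup m k)"
    by (rule prod.mono_neutral_right) (auto simp: in_keys_iff)
  finally show ?thesis .
qed

lemma mpoly_eval_expand_in_var:
  assumes d: "\<And>m. m \<in> Poly_Mapping.keys P \<Longrightarrow> Poly_Mapping.lookup m N \<le> d"
  shows "mpoly_eval P a = (\<Sum>j\<le>d. mpoly_eval (coeff_of_var_power N j P) a * a N ^ j)"
proof -
  let ?t = "\<lambda>m. Poly_Mapping.lookup P m * (\<Prod>k\<in>Poly_Mapping.keys m. a k ^ Poly_Mapping.lookup m k)"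
  have "mpoly_eval P a = (\<Sum>j\<le>d. \<Sum>m | m \<in> Poly_Mapping.keys P \<and> Poly_Mapping.lookup m N = j. ?t m)"
    unfolding mpoly_eval_def
    by (rule sum.group[symmetric]) (use d in auto)
  also have "\<dots> = (\<Sum>j\<le>d. mpoly_eval (coeff_of_var_power N j P) a * a N ^ j)"
  proof (rule sum.cong[OF refl])
    fix j
    have "(\<Sum>m | m \<in> Poly_Mapping.keys P \<and> Poly_Mapping.lookup m N = j. ?t m) =
        (\<Sum>m\<in>Poly_Mapping.keys (coeff_of_var_power N j P). ?t (m + Poly_Mapping.single N j))"
      by (rule sum.reindex_bij_betw[OF bij_betw_keys_coeff_of_var_power, symmetric])
    also have "\<dots> = mpoly_eval (coeff_of_var_power N j P) a * a N ^ j"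
      unfolding mpoly_eval_def sum_distrib_right monomial_value_times_var_power
      by (rule sum.cong) (auto simp: keys_coeff_of_var_power coeff_of_var_power.rep_eq)
    finally show "(\<Sum>m | m \<in> Poly_Mapping.keys P \<and> Poly_Mapping.lookup m N = j. ?t m) =
        mpoly_eval (coeff_of_var_power N j P) a * a N ^ j" .
  qed
  finally show ?thesis .
qed

lemma holomorphic_mpoly_comp:
  assumes "\<And>k. k \<in> occurring_vars P \<Longrightarrow> f k holomorphic_on UNIV"
  shows "mpoly_comp P f holomorphic_on UNIV"
  unfolding mpoly_comp_def mpoly_eval_def
  using assms
  by (intro holomorphic_on_sum holomorphic_on_mult holomorphic_on_const holomorphic_on_prod
      holomorphic_on_power) (auto simp: occurring_vars_def)

lemma slow_mpoly_comp:
  assumes f: "\<And>k. k \<in> occurring_vars P \<Longrightarrow> slow \<beta> (f k)"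
  shows "slow \<beta> (mpoly_comp P f)"
proof (rule slow_of_dominated)
  let ?t = "\<lambda>m z. Poly_Mapping.lookup P m * (\<Prod>k\<in>Poly_Mapping.keys m. f k z ^ Poly_Mapping.lookup m k)"
  show "mpoly_comp P f holomorphic_on UNIV"
    using f by (intro holomorphic_mpoly_comp) (auto simp: slow_def)
  show "norm (mpoly_comp P f z) \<le> (\<Sum>m\<in>Poly_Mapping.keys P. norm (?t m z))" for z
    unfolding mpoly_comp_def mpoly_eval_def by (rule norm_sum)
  show "slow \<beta> (?t m)" if "m \<in> Poly_Mapping.keys P" for m
    using that f by (intro slow_mult slow_const slow_prod slow_power) (auto simp: occurring_vars_def)
qed simp

definition var_degree :: "nat \<Rightarrow> cmpoly \<Rightarrow> nat" where
  "var_degree N P = Max ((\<lambda>m. Poly_Mapping.lookup m N) ` Poly_Mapping.keys P)"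

lemma
  assumes N: "N \<in> occurring_vars P"
  shows var_degree_ge_1: "var_degree N P \<ge> 1"
    and leading_coeff_nonzero: "coeff_of_var_power N (var_degree N P) P \<noteq> 0"
    and lookup_le_var_degree: "\<And>m. m \<in> Poly_Mapping.keys P \<Longrightarrow> Poly_Mapping.lookup m N \<le> var_degree N P"
proof -
  show le: "\<And>m. m \<in> Poly_Mapping.keys P \<Longrightarrow> Poly_Mapping.lookup m N \<le> var_degree N P"
    unfolding var_degree_def by simp
  obtain m where "m \<in> Poly_Mapping.keys P" "N \<in> Poly_Mapping.keys m"
    using N by (auto simp: occurring_vars_def)
  then show "var_degree N P \<ge> 1" using le[of m] by (simp add: in_keys_iff)
  have "var_degree N P \<in> (\<lambda>m. Poly_Mapping.lookup m N) ` Poly_Mapping.keys P"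
    unfolding var_degree_def using \<open>m \<in> Poly_Mapping.keys P\<close> by (intro Max_in) auto
  then have "{m \<in> Poly_Mapping.keys P. Poly_Mapping.lookup m N = var_degree N P} \<noteq> {}" by auto
  then have "Poly_Mapping.keys (coeff_of_var_power N (var_degree N P) P) \<noteq> {}"
    unfolding bij_betw_imp_surj_on[OF bij_betw_keys_coeff_of_var_power, symmetric] by simp
  then show "coeff_of_var_power N (var_degree N P) P \<noteq> 0" by auto
qed

section \<open>The order of a polynomial in functions of distinct orders\<close>

text \<open>If all variables but one are slow and so is the value of the polynomial, then the remaining
  function \<open>f N\<close> is a root of a polynomial with slow coefficients: the \<open>q j\<close>, with the value subtracted from \<open>q 0\<close>. The bound for the leading term
  makes \<open>q d * f N\<close> slow, and \<open>f N\<close> is the quotient of this function by \<open>q d\<close>.\<close>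

lemma slow_var_if_slow_mpoly_comp:
  assumes N: "N \<in> occurring_vars P" and fN: "f N holomorphic_on UNIV"
    and others: "\<And>k. k \<in> occurring_vars P - {N} \<Longrightarrow> slow \<beta> (f k)"
    and lead: "mpoly_comp (coeff_of_var_power N (var_degree N P) P) f \<noteq> (\<lambda>z. 0)"
    and slow: "slow \<beta> (mpoly_comp P f)"
  shows "slow \<beta> (f N)"
proof -
  let ?d = "var_degree N P"
  define q where "q j = mpoly_comp (coeff_of_var_power N j P) f" for j
  have q: "slow \<beta> (q j)" for j
    unfolding q_def using others occurring_vars_coeff_of_var_power by (intro slow_mpoly_comp) blast
  have expand: "mpoly_comp P f z = (\<Sum>j\<le>?d. q j z * f N z ^ j)" for z
    unfolding mpoly_comp_def q_def using lookup_le_var_degree[OF N] by (rule mpoly_eval_expand_in_var)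
  have "slow \<beta> (\<lambda>z. q ?d z * f N z)"
  proof (rule slow_of_dominated)
    \<comment> \<open>The dominating family is indexed by \<open>None\<close> for the value of the polynomial and by
      \<open>Some j\<close> for the coefficients.\<close>
    let ?c = "\<lambda>i. case i of None \<Rightarrow> mpoly_comp P f | Some j \<Rightarrow> q j"
    show "(\<lambda>z. q ?d z * f N z) holomorphic_on UNIV"
      using q[of ?d] fN by (auto simp: slow_def intro!: holomorphic_intros)
    show "finite (insert None (Some ` {..?d}))" by simp
    show "slow \<beta> (?c i)" for i using q slow by (cases i) auto
    show "norm (q ?d z * f N z) \<le> (\<Sum>i\<in>insert None (Some ` {..?d}). norm (?c i z))" for z
      using leading_term_bound[OF var_degree_ge_1[OF N], of "\<lambda>j. q j z" "f N z"]
      by (simp add: expand sum.reindex)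
  qed
  moreover obtain c where "q ?d c \<noteq> 0" using lead unfolding q_def by blast
  ultimately show ?thesis
    using slow_quotient[of "f N" \<beta> "q ?d" c] fN q[of ?d] by (simp add: mult.commute)
qed

lemma constant_mpoly_iff: "constant_mpoly P \<longleftrightarrow> occurring_vars P = {}"
proof
  assume empty: "occurring_vars P = {}"
  have "m = 0" if "m \<in> Poly_Mapping.keys P" for m
  proof -
    have "Poly_Mapping.keys m = {}" using empty that unfolding occurring_vars_def by blast
    then show ?thesis by simp
  qed
  then have "Poly_Mapping.lookup P m = Poly_Mapping.lookup (Poly_Mapping.single 0 (Poly_Mapping.lookup P 0)) m" for m
    by (cases "m = 0") (auto simp: lookup_single when_def in_keys_iff)
  then have "P = Poly_Mapping.single 0 (Poly_Mapping.lookup P 0)"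
    by (rule poly_mapping_eqI)
  then show "constant_mpoly P" unfolding constant_mpoly_def by (rule exI)
next
  assume "constant_mpoly P"
  then obtain c where "P = Poly_Mapping.single 0 c" by (auto simp: constant_mpoly_def)
  then show "occurring_vars P = {}" by (cases "c = 0") (simp_all add: occurring_vars_def)
qed

locale distinct_orders =
  fixes V :: "nat set" and f :: "nat \<Rightarrow> complex \<Rightarrow> complex"
  assumes holomorphic: "k \<in> V \<Longrightarrow> f k holomorphic_on UNIV"
    and nonconstant: "k \<in> V \<Longrightarrow> \<not> f k constant_on UNIV"
    and inj_order: "inj_on (\<lambda>k. growth_order (f k)) V"
begin

text \<open>Since the orders are distinct, the maximum is attained at a single variable, and the order of
  its function separates it from all the others.\<close>

lemma obtain_dominant_var:
  assumes "occurring_vars P \<subseteq> V" "occurring_vars P \<noteq> {}"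
  obtains N where "N \<in> occurring_vars P"
    "Max ((\<lambda>k. growth_order (f k)) ` occurring_vars P) = growth_order (f N)"
    "\<And>k. k \<in> occurring_vars P - {N} \<Longrightarrow> slow (growth_order (f N)) (f k)"
    "\<not> slow (growth_order (f N)) (f N)"
proof -
  have "Max ((\<lambda>k. growth_order (f k)) ` occurring_vars P) \<in> (\<lambda>k. growth_order (f k)) ` occurring_vars P"
    using assms finite_occurring_vars by (intro Max_in) auto
  then obtain N where N: "N \<in> occurring_vars P"
    "Max ((\<lambda>k. growth_order (f k)) ` occurring_vars P) = growth_order (f N)" by auto
  have "slow (growth_order (f N)) (f k)" if k: "k \<in> occurring_vars P - {N}" for k
  proof -
    have "growth_order (f k) \<le> growth_order (f N)"
      unfolding N(2)[symmetric] using k finite_occurring_vars by (intro Max_ge) auto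
    moreover have "growth_order (f k) \<noteq> growth_order (f N)"
      using inj_order k N(1) assms(1) by (auto dest: inj_onD)
    ultimately show ?thesis using holomorphic k assms(1) by (auto simp: slow_def)
  qed
  moreover have "\<not> slow (growth_order (f N)) (f N)"
    using nonconstant N(1) assms(1) by (auto simp: slow_def)
  ultimately show ?thesis using N that by blast
qed

text \<open>By induction on the number of variables, the leading coefficient in the dominant variable \<open>z\<^sub>N\<close>
  does not vanish at \<open>f\<close>. The zero function is slow, so if it were the value of \<open>P\<close>, then \<open>f N\<close> would be
  slow for its own order. When that order is \<open>0\<close>, the same argument says that a root of a polynomial
  with constant coefficients is constant.\<close>

lemma mpoly_comp_nonzero:
  assumes "occurring_vars P \<subseteq> V" "P \<noteq> 0"
  shows "mpoly_comp P f \<noteq> (\<lambda>z. 0)"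
  using assms
proof (induction "card (occurring_vars P)" arbitrary: P rule: less_induct)
  case less
  show ?case
  proof (cases "occurring_vars P = {}")
    case True
    then have "constant_mpoly P" by (simp add: constant_mpoly_iff)
    then obtain c where "P = Poly_Mapping.single 0 c" unfolding constant_mpoly_def by (rule exE)
    then show ?thesis using less.prems by (auto simp: mpoly_comp_def mpoly_eval_def fun_eq_iff)
  next
    case False
    obtain N where N: "N \<in> occurring_vars P"
      "\<And>k. k \<in> occurring_vars P - {N} \<Longrightarrow> slow (growth_order (f N)) (f k)"
      "\<not> slow (growth_order (f N)) (f N)"
      using obtain_dominant_var[OF less.prems(1) False] by metis
    have fN: "f N holomorphic_on UNIV" using N(1) less.prems(1) by (intro holomorphic) blast
    let ?Q = "coeff_of_var_power N (var_degree N P) P"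
    have sub: "occurring_vars ?Q \<subseteq> occurring_vars P - {N}"
      by (rule occurring_vars_coeff_of_var_power)
    then have "card (occurring_vars ?Q) < card (occurring_vars P)"
      using N(1) finite_occurring_vars by (intro psubset_card_mono) auto
    then have "mpoly_comp ?Q f \<noteq> (\<lambda>z. 0)"
      using sub less.prems(1) leading_coeff_nonzero[OF N(1)] by (intro less.hyps) auto
    then have "\<not> slow (growth_order (f N)) (mpoly_comp P f)"
      using slow_var_if_slow_mpoly_comp[where f = f, OF N(1) fN N(2)] N(3) by metis
    then show ?thesis using slow_const by metis
  qed
qed

text \<open>An order of the value below that of the dominant function would make the dominant function slow
  for its own order. Conversely, every bound above all the orders is inherited by the value.\<close>

lemma growth_order_mpoly_comp:
  assumes V: "occurring_vars P \<subseteq> V" and P: "\<not> constant_mpoly P"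
  shows "growth_order (mpoly_comp P f) = Max ((\<lambda>k. growth_order (f k)) ` occurring_vars P)"
proof -
  have ne: "occurring_vars P \<noteq> {}" using P constant_mpoly_iff by blast
  obtain N where N: "N \<in> occurring_vars P"
      "Max ((\<lambda>k. growth_order (f k)) ` occurring_vars P) = growth_order (f N)"
      "\<And>k. k \<in> occurring_vars P - {N} \<Longrightarrow> slow (growth_order (f N)) (f k)"
      "\<not> slow (growth_order (f N)) (f N)"
    using obtain_dominant_var[OF V ne] by blast
  have fN: "f N holomorphic_on UNIV" using N(1) V by (intro holomorphic) blast
  have hol: "mpoly_comp P f holomorphic_on UNIV"
    using V holomorphic by (intro holomorphic_mpoly_comp) auto
  have "mpoly_comp (coeff_of_var_power N (var_degree N P) P) f \<noteq> (\<lambda>z. 0)"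
    using V occurring_vars_coeff_of_var_power[of N "var_degree N P" P]
    by (intro mpoly_comp_nonzero leading_coeff_nonzero[OF N(1)]) blast
  then have "\<not> slow (growth_order (f N)) (mpoly_comp P f)"
    using slow_var_if_slow_mpoly_comp[where f = f, OF N(1) fN N(3)] N(4) by metis
  then have "growth_order (f N) \<le> growth_order (mpoly_comp P f)"
    using hol by (auto simp: slow_def)
  moreover have "growth_order (mpoly_comp P f) \<le> growth_order (f N)"
  proof (rule dense_ge)
    fix \<beta> assume \<beta>: "growth_order (f N) < \<beta>"
    have "slow \<beta> (f k)" if "k \<in> occurring_vars P" for k
    proof -
      have "growth_order (f k) \<le> growth_order (f N)"
        unfolding N(2)[symmetric] using that finite_occurring_vars by (intro Max_ge) auto
      moreover have "f k holomorphic_on UNIV" using V that by (intro holomorphic) blast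
      ultimately show ?thesis using le_less_trans[OF _ \<beta>] by (simp add: slow_def)
    qed
    then have slow: "slow \<beta> (mpoly_comp P f)" by (rule slow_mpoly_comp[where f = f])
    have "\<beta> > 0" using growth_order_nonneg[of "f N"] \<beta> by (rule le_less_trans)
    have "growth_order (mpoly_comp P f) < \<beta>"
      using slow hol unfolding slow_pos_iff[OF \<open>\<beta> > 0\<close>]
      by (simp add: growth_order_less_iff holomorphic_on_imp_continuous_on)
    then show "growth_order (mpoly_comp P f) \<le> \<beta>" by simp
  qed
  ultimately show ?thesis using N(2) by simp
qed

end

theorem lemma2p4:
  fixes M :: nat and f :: "nat \<Rightarrow> complex \<Rightarrow> complex"
  assumes "M \<ge> 1"
    and "\<And>k. k \<in> {1..M} \<Longrightarrow> f k holomorphic_on UNIV"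
    and "\<And>k. k \<in> {1..M} \<Longrightarrow> \<not> f k constant_on UNIV"
    and "\<And>i j. i \<in> {1..M} \<Longrightarrow> j \<in> {1..M} \<Longrightarrow> i \<noteq> j \<Longrightarrow> growth_order (f i) \<noteq> growth_order (f j)"
  shows "(\<forall>P\<in>mpolys M. \<not> constant_mpoly P \<longrightarrow>
            growth_order (mpoly_comp P f) = Max ((\<lambda>k. growth_order (f k)) ` occurring_vars P)) \<and>
         algebraically_independent M f \<and> generates_free_algebra M f"
proof -
  interpret distinct_orders "{1..M}" f
  proof
    show "f k holomorphic_on UNIV" "\<not> f k constant_on UNIV" if "k \<in> {1..M}" for k
      using that assms(2)[of k] assms(3)[of k] by simp_all
    show "inj_on (\<lambda>k. growth_order (f k)) {1..M}"
      by (rule inj_onI, rule ccontr) (use assms(4) in blast)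
  qed
  show ?thesis
    unfolding algebraically_independent_def generates_free_algebra_def mpolys_def
    using growth_order_mpoly_comp mpoly_comp_nonzero by blast
qed

end
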